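(* Let $(\mathcal Q,d)$ be a Hadamard space, let $Y$ be a $\mathcal Q$-valued random variable concentrated on a separable set, let $m$ be a Fréchet median of $Y$, and let $m_n$ be an empirical Fréchet median of $n\in\mathbb N$ independent copies $Y_1,\dots,Y_n$ of $Y$. Let $r\in[0,\infty)$ and set $\rho:=\mathbf P(d(Y,m)\le r)$. Let $\eta\in(0,1]$. Assume $2\eta\rho>1$. Then $$\mathbf P\left(d(m,m_n)>\frac{6\eta\rho-1-4\eta^2\rho^2}{2\eta\rho-1}\,r\right)\le\exp\big(-n\,\mathrm{KL}(\eta\rho,\rho)\big).$$
   Context: A Hadamard space is a nonempty complete metric space $(\mathcal Q,d)$ such that for all $y_0,y_1\in\mathcal Q$ there is $p\in\mathcal Q$ with $\frac12 d(y_0,q)^2+\frac12 d(y_1,q)^2-\frac14 d(y_0,y_1)^2\ge d(q,p)^2$ for all $q\in\mathcal Q$; it carries its Borel $\sigma$-algebra. "Concentrated on a separable set" means $\mathbf P(Y\in\mathcal Y)=1$ for some separable $\mathcal Y\subset\mathcal Q$. A Fréchet median of $Y$ is any $m\in\arg\min_{q\in\mathcal Q}\mathbf E[d(Y,q)-d(Y,o)]$ with an arbitrary reference point $o\in\mathcal Q$ (independent of $o$; no moment condition needed). $m_n\in\arg\min_{q\in\mathcal Q}\sum_{j=1}^n d(Y_j,q)$ is a measurable function of $(Y_1,\dots,Y_n)$. The binary relative entropy is $\mathrm{KL}(t,p):=t\log\frac tp+(1-t)\log\frac{1-t}{1-p}$ for $t,p\in[0,1]$, with conventions $0\log0=0$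 and $\mathrm{KL}(t,p)=+\infty$ if $t\notin\{0,1\}$ and $p\in\{0,1\}$; $\exp(-\infty)=0$. *)

theory Defs
  imports "HOL-Probability.Probability"
begin

class hadamard_space = complete_space +
  assumes hadamard:
    "\<exists>p. \<forall>q. 1/2 * (dist y0 q)\<^sup>2 + 1/2 * (dist y1 q)\<^sup>2 - 1/4 * (dist y0 y1)\<^sup>2 \<ge> (dist q p)\<^sup>2"

text \<open>
  The reference point \<open>z\<close> makes the integrand bounded, by \<open>dist q z\<close> in absolute value, so
  that for a random variable \<open>Y\<close> the integral always exists; the choice of \<open>z\<close> shifts the
  objective by a constant and does not affect the minimizers.
\<close>

definition frechet_median :: "'w measure \<Rightarrow> ('w \<Rightarrow> 'a::metric_space) \<Rightarrow> 'a \<Rightarrow> 'a \<Rightarrow> bool" where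
  "frechet_median M Y z m \<longleftrightarrow>
     is_arg_min (\<lambda>q. \<integral>\<omega>. (dist (Y \<omega>) q - dist (Y \<omega>) z) \<partial>M) (\<lambda>q. True) m"

definition empirical_frechet_median :: "nat \<Rightarrow> (nat \<Rightarrow> 'a::metric_space) \<Rightarrow> 'a \<Rightarrow> bool" where
  "empirical_frechet_median n y m \<longleftrightarrow>
     is_arg_min (\<lambda>q. \<Sum>j\<in>{1..n}. dist (y j) q) (\<lambda>q. True) m"

definition concentrated_on_separable :: "'w measure \<Rightarrow> ('w \<Rightarrow> 'a::metric_space) \<Rightarrow> bool" where
  "concentrated_on_separable M Y \<longleftrightarrow>
     (\<exists>S. separable_space (top_of_set S) \<and> measure M {\<omega> \<in> space M. Y \<omega> \<in> S} = 1)"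

text \<open>
  For \<open>a, b \<in> [0,1]\<close>, this is \<open>a * log (a/b)\<close> with \<open>0 * log (0/b) = 0\<close>, also for \<open>b = 0\<close>,
  and \<open>a * log (a/0) = \<infinity>\<close> for \<open>a > 0\<close>.
\<close>

definition kl_term :: "real \<Rightarrow> real \<Rightarrow> ereal" where
  "kl_term a b = (if a = 0 then 0 else if b = 0 then \<infinity> else ereal (a * ln (a / b)))"

definition KL :: "real \<Rightarrow> real \<Rightarrow> ereal" where
  "KL t p = kl_term t p + kl_term (1 - t) (1 - p)"

definition ereal_exp :: "ereal \<Rightarrow> ereal" where
  "ereal_exp x = (if x = - \<infinity> then 0 else if x = \<infinity> then \<infinity> else ereal (exp (real_of_ereal x)))"

end

theory Submission
  imports Defs
begin

text \<open>
  Write \<open>a = \<eta> * \<rho>\<close>, so \<open>1/2 < a \<le> \<rho>\<close>. The proof separates a deterministic statement about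
  medians from a binomial tail bound.

  Suppose that more than a fraction \<open>a\<close> of the sample lies within distance \<open>r\<close> of \<open>m\<close>, and that
  the empirical median \<open>p\<close> is at distance \<open>D > r\<close> from \<open>m\<close>. Move from \<open>p\<close> towards \<open>m\<close> along the
  geodesic. The distance to any sample point grows at most at unit speed, whereas nonpositive
  curvature makes the distance to each point of the ball around \<open>m\<close> shrink initially at a speed of
  at least \<open>sqrt (D\<^sup>2 - r\<^sup>2) / D\<close>. In the Euclidean plane, this is the cosine of the angle at \<open>p\<close>
  between the direction to \<open>m\<close> and a ray tangent to the ball. As \<open>p\<close> is a minimizer,
  \<open>a * sqrt (D\<^sup>2 - r\<^sup>2) \<le> (1 - a) * D\<close>, that is, \<open>(2 * a - 1) * D\<^sup>2 \<le> a\<^sup>2 * r\<^sup>2\<close>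
  (\<open>median_near_majority\<close>). This is stronger than the radius in the theorem, since
  \<open>6 * a - 1 - 4 * a\<^sup>2 = 1 + 2 * (1 - a) * (2 * a - 1)\<close> is at least \<open>1\<close>, while
  \<open>(2 * a - 1) * a\<^sup>2 \<le> 1\<close>.

  Hence the median can be far from \<open>m\<close> only if at most \<open>a * n\<close> of the \<open>n\<close> sample points lie in a
  ball of probability \<open>\<rho> \<ge> a\<close>. The probability of this is bounded by the Chernoff bound for the
  lower tail of the binomial distribution (\<open>chernoff_lower_tail_KL\<close>).
\<close>

section \<open>Points on a geodesic\<close>

text \<open>
  The inequality says that \<open>c\<close> divides the geodesic from \<open>p\<close> to \<open>x\<close> in the proportion
  \<open>t : (1 - t)\<close> and that triangles over this geodesic are no fatter than Euclidean ones, where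
  equality holds (Stewart's theorem).
\<close>

definition comparison_point :: "'a::metric_space \<Rightarrow> 'a \<Rightarrow> real \<Rightarrow> 'a \<Rightarrow> bool" where
  "comparison_point p x t c \<longleftrightarrow>
     (\<forall>q. (dist q c)\<^sup>2 \<le> (1 - t) * (dist q p)\<^sup>2 + t * (dist q x)\<^sup>2 - t * (1 - t) * (dist p x)\<^sup>2)"

text \<open>
  Taking \<open>q = p\<close> and \<open>q = x\<close> gives the upper bounds \<open>t * dist p x\<close> and \<open>(1 - t) * dist p x\<close> for
  the distances of \<open>c\<close> from the endpoints; by the triangle inequality both must be attained.
\<close>

lemma comparison_point_dist:
  assumes c: "comparison_point p x t c" and t: "0 \<le> t" "t \<le> 1"
  shows "dist p c = t * dist p x"
proof -
  have "(dist p c)\<^sup>2 \<le> (t * dist p x)\<^sup>2"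
    using c[unfolded comparison_point_def, rule_format, of p]
    by (simp add: power2_eq_square algebra_simps)
  then have 1: "dist p c \<le> t * dist p x"
    by (rule power2_le_imp_le) (use t in simp)
  have "(dist x c)\<^sup>2 \<le> ((1 - t) * dist p x)\<^sup>2"
    using c[unfolded comparison_point_def, rule_format, of x]
    by (simp add: power2_eq_square algebra_simps dist_commute)
  then have "dist x c \<le> (1 - t) * dist p x"
    by (rule power2_le_imp_le) (use t in simp)
  then have "t * dist p x \<le> dist p c"
    using dist_triangle[of p x c] by (simp add: algebra_simps dist_commute)
  with 1 show ?thesis by simp
qed

text \<open>
  Only points near \<open>p\<close> matter for a first-order condition at \<open>p\<close>, so repeated bisection towards
  \<open>p\<close> can take the place of a construction of the whole geodesic.
\<close>

lemma comparison_point_dyadic_exists: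
  fixes p x :: "'a::hadamard_space"
  shows "\<exists>c. comparison_point p x ((1/2) ^ i) c"
proof (induction i)
  case 0
  have "comparison_point p x ((1/2) ^ 0) x"
    by (simp add: comparison_point_def)
  then show ?case ..
next
  case (Suc i)
  define t :: real where "t = (1/2) ^ i"
  have t: "0 \<le> t" "t \<le> 1" by (auto simp: t_def power_le_one)
  from Suc obtain c where c: "comparison_point p x t c" by (auto simp: t_def)
  have dc: "dist p c = t * dist p x" using comparison_point_dist[OF c t] .
  obtain c' where c': "\<And>q. (dist p q)\<^sup>2 / 2 + (dist c q)\<^sup>2 / 2 - (dist p c)\<^sup>2 / 4 \<ge> (dist q c')\<^sup>2"
    using hadamard[of p c] by auto
  have "comparison_point p x (t / 2) c'"
    unfolding comparison_point_def
  proof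
    fix q
    have "(dist q c')\<^sup>2 \<le> (dist q p)\<^sup>2 / 2 + (dist q c)\<^sup>2 / 2 - (t * dist p x)\<^sup>2 / 4"
      using c'[of q] by (simp add: dc dist_commute[of _ q])
    also have "\<dots> \<le> (dist q p)\<^sup>2 / 2
        + ((1 - t) * (dist q p)\<^sup>2 + t * (dist q x)\<^sup>2 - t * (1 - t) * (dist p x)\<^sup>2) / 2
        - (t * dist p x)\<^sup>2 / 4"
      using c[unfolded comparison_point_def, rule_format, of q]
      by (intro diff_right_mono add_left_mono divide_right_mono) auto
    also have "\<dots> = (1 - t/2) * (dist q p)\<^sup>2 + t/2 * (dist q x)\<^sup>2 - t/2 * (1 - t/2) * (dist p x)\<^sup>2"
      by (simp add: power2_eq_square field_simps)
    finally show "(dist q c')\<^sup>2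
        \<le> (1 - t/2) * (dist q p)\<^sup>2 + t/2 * (dist q x)\<^sup>2 - t/2 * (1 - t/2) * (dist p x)\<^sup>2" .
  qed
  then show ?case by (auto simp: t_def)
qed

section \<open>Medians stay close to a majority of the points\<close>

text \<open>
  Concavity of the square root turns the comparison inequality for squared distances into
  \<open>dist y c - s \<le> t * (r\<^sup>2 - s\<^sup>2 - (1 - t) * D\<^sup>2) / (2 * s)\<close> with \<open>s = dist y p \<ge> D - r\<close>.
  By the inequality of arithmetic and geometric means, \<open>(s\<^sup>2 + (D\<^sup>2 - r\<^sup>2)) / (2 * s)\<close> is at least
  \<open>sqrt (D\<^sup>2 - r\<^sup>2)\<close>; the remainder is of second order in \<open>t\<close>, uniformly in \<open>y\<close>.
\<close>

lemma dist_decrease_towards_ball: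
  assumes c: "comparison_point p x t c" and t: "0 \<le> t"
    and y: "dist y x \<le> r" and far: "r < dist p x"
  defines "D \<equiv> dist p x"
  shows "dist y c - dist y p \<le> t * (t * (D\<^sup>2 / (2 * (D - r))) - sqrt (D\<^sup>2 - r\<^sup>2))"
proof -
  define s where "s = dist y p"
  define S where "S = sqrt (D\<^sup>2 - r\<^sup>2)"
  have r: "0 \<le> r" using y zero_le_dist[of y x] by linarith
  have s: "D - r \<le> s"
    using dist_triangle[of p x y] y by (simp add: D_def s_def dist_commute)
  have Dr: "0 < D - r" using far by (simp add: D_def)
  have s0: "0 < s" using s Dr by linarith
  have S2: "S\<^sup>2 = D\<^sup>2 - r\<^sup>2"
    using r Dr by (simp add: S_def power_mono)
  have "(dist y x)\<^sup>2 \<le> r\<^sup>2" using y by (simp add: power_mono)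
  then have "t * (dist y x)\<^sup>2 \<le> t * r\<^sup>2" using t by (rule mult_left_mono)
  then have sq: "(dist y c)\<^sup>2 \<le> (1 - t) * s\<^sup>2 + t * r\<^sup>2 - t * (1 - t) * D\<^sup>2"
    using c[unfolded comparison_point_def, rule_format, of y] by (simp add: s_def D_def)
  have "2 * s * (dist y c - s) \<le> (dist y c)\<^sup>2 - s\<^sup>2"
    using zero_le_power2[of "dist y c - s"] by (simp add: power2_eq_square algebra_simps)
  also have "\<dots> \<le> t * (t * D\<^sup>2 - (s\<^sup>2 + S\<^sup>2))"
    using sq unfolding S2 by (simp add: algebra_simps power2_eq_square)
  also have "\<dots> \<le> t * (t * D\<^sup>2 - 2 * s * S)"
    using t sum_squares_bound[of s S] by (intro mult_left_mono) auto
  finally have "dist y c - s \<le> t * (t * D\<^sup>2 - 2 * s * S) / (2 * s)"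
    using s0 by (simp add: pos_le_divide_eq mult.commute)
  also have "\<dots> = t * (t * (D\<^sup>2 / (2 * s)) - S)"
    using s0 by (simp add: field_simps)
  also have "\<dots> \<le> t * (t * (D\<^sup>2 / (2 * (D - r))) - S)"
    using t s Dr by (intro mult_left_mono diff_right_mono divide_left_mono) auto
  finally show ?thesis by (simp add: s_def S_def)
qed

text \<open>
  The conclusion is equivalent to \<open>dist p x \<le> a / sqrt (2 * a - 1) * r\<close>. For \<open>dist p x \<le> r\<close> it
  holds because \<open>2 * a - 1 \<le> a\<^sup>2\<close>. Otherwise the minimality of \<open>p\<close> among the points of the
  geodesic towards \<open>x\<close>, divided by the step \<open>t\<close> and with \<open>t\<close> tending to \<open>0\<close>, yields the
  first-order condition.
\<close>

lemma median_near_majority: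
  fixes p x :: "'a::hadamard_space"
  assumes fin: "finite I"
    and min: "\<And>q. (\<Sum>i\<in>I. dist (y i) p) \<le> (\<Sum>i\<in>I. dist (y i) q)"
    and majority: "a * real (card I) < real (card {i\<in>I. dist (y i) x \<le> r})"
    and a: "0 \<le> a" "2 * a > 1" and r: "0 \<le> r"
  shows "(2 * a - 1) * (dist p x)\<^sup>2 \<le> a\<^sup>2 * r\<^sup>2"
proof (cases "dist p x \<le> r")
  case True
  have "(2 * a - 1) * (dist p x)\<^sup>2 \<le> (2 * a - 1) * r\<^sup>2"
    using True a by (intro mult_left_mono power_mono) auto
  also have "\<dots> \<le> a\<^sup>2 * r\<^sup>2"
    using zero_le_power2[of "a - 1"]
    by (intro mult_right_mono) (auto simp: power2_eq_square algebra_simps)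
  finally show ?thesis .
next
  case False
  define D where "D = dist p x"
  define S where "S = sqrt (D\<^sup>2 - r\<^sup>2)"
  define E where "E = D\<^sup>2 / (2 * (D - r))"
  define J where "J = {i\<in>I. dist (y i) x \<le> r}"
  define n where "n = real (card I)"
  define k where "k = real (card J)"
  have D: "r < D" "0 < D" using False r by (auto simp: D_def)
  have J: "J \<subseteq> I" "finite J" using fin by (auto simp: J_def)
  have kn: "k \<le> n" using J fin by (simp add: k_def n_def card_mono)
  have ak: "a * n < k" using majority by (simp add: n_def k_def J_def)
  have S0: "0 \<le> S" and S2: "S\<^sup>2 = D\<^sup>2 - r\<^sup>2"
    using D r by (auto simp: S_def power_mono)
  have step: "0 \<le> (n - k) * D + k * ((1/2) ^ i * E - S)" for i
  proof -
    define t :: real where "t = (1/2) ^ i"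
    have t: "0 < t" "t \<le> 1" by (auto simp: t_def power_le_one)
    obtain c where c: "comparison_point p x t c"
      using comparison_point_dyadic_exists[of p x i] by (auto simp: t_def)
    have near: "dist (y j) c - dist (y j) p \<le> t * (t * E - S)" if "j \<in> J" for j
      using dist_decrease_towards_ball[OF c, of "y j" r] that t False
      by (simp add: J_def D_def E_def S_def)
    have any: "dist (y j) c - dist (y j) p \<le> t * D" for j
      using dist_triangle[of "y j" c p] comparison_point_dist[OF c] t by (simp add: D_def)
    have "0 \<le> (\<Sum>j\<in>I. dist (y j) c - dist (y j) p)"
      using min[of c] by (simp add: sum_subtractf)
    also have "\<dots> = (\<Sum>j\<in>I - J. dist (y j) c - dist (y j) p) + (\<Sum>j\<in>J. dist (y j) c - dist (y j) p)"
      using J fin by (intro sum.subset_diff)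
    also have "\<dots> \<le> real (card (I - J)) * (t * D) + real (card J) * (t * (t * E - S))"
      by (intro add_mono sum_bounded_above near any)
    also have "\<dots> = t * ((n - k) * D + k * (t * E - S))"
      using J fin by (simp add: n_def k_def card_Diff_subset of_nat_diff card_mono algebra_simps)
    finally show ?thesis
      using t by (simp add: zero_le_mult_iff flip: t_def)
  qed
  have "(\<lambda>i. (n - k) * D + k * ((1/2) ^ i * E - S)) \<longlonglongrightarrow> (n - k) * D + k * (0 * E - S)"
    by (intro tendsto_intros LIMSEQ_power_zero) simp
  then have "0 \<le> (n - k) * D + k * (0 * E - S)"
    by (rule LIMSEQ_le_const) (use step in blast)
  then have foc: "k * S \<le> (n - k) * D" by simp
  have "0 \<le> a * n" using a by (simp add: n_def)
  then have n: "0 < n" using ak kn by linarith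
  have "n * (a * S) \<le> k * S"
    using ak S0 by (simp add: mult.assoc[symmetric] mult.commute[of n] mult_right_mono)
  also note foc
  also have "(n - k) * D \<le> (n - a * n) * D"
    using ak D by (intro mult_right_mono) auto
  finally have "n * (a * S) \<le> n * ((1 - a) * D)" by (simp add: algebra_simps)
  then have "a * S \<le> (1 - a) * D" using n by simp
  then have "(a * S)\<^sup>2 \<le> ((1 - a) * D)\<^sup>2" using a S0 by (intro power_mono) auto
  then show ?thesis
    by (simp add: power_mult_distrib S2 D_def[symmetric])
       (simp add: power2_eq_square algebra_simps)
qed

section \<open>The lower tail of a binomial count\<close>

context prob_space
begin

text \<open>
  Markov's inequality is applied to \<open>s ^ k\<close>, where \<open>k\<close> is the count and \<open>s \<le> 1\<close>. By independence,
  its expectation is \<open>(1 - p + p * s) ^ n\<close>. The value of \<open>s\<close> that minimizes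
  \<open>s powr (- a) * (1 - p + p * s)\<close> produces the relative entropy.
\<close>

lemma chernoff_lower_tail:
  fixes X :: "'i \<Rightarrow> 'a \<Rightarrow> 'b"
  assumes fin: "finite I" and ind: "indep_vars (\<lambda>_. N) X I" and B: "B \<in> sets N"
    and p: "\<And>i. i \<in> I \<Longrightarrow> prob {\<omega>\<in>space M. X i \<omega> \<in> B} = p"
    and a: "0 < a" "a \<le> p" and p1: "p < 1"
  shows "prob {\<omega>\<in>space M. real (card {i\<in>I. X i \<omega> \<in> B}) \<le> a * real (card I)}
         \<le> exp (- (real (card I) * (a * ln (a / p) + (1 - a) * ln ((1 - a) / (1 - p)))))"
proof -
  define n where "n = card I"
  define s where "s = a * (1 - p) / (p * (1 - a))"
  define g where "g = (\<lambda>x. if x \<in> B then s else 1)"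
  define V where "V = (\<lambda>\<omega>. \<Prod>i\<in>I. g (X i \<omega>))"
  define k where "k = (\<lambda>\<omega>. card {i\<in>I. X i \<omega> \<in> B})"
  have pos: "0 < p" "0 < 1 - a" "0 < 1 - p" using a p1 by auto
  have s0: "0 < s" using a pos by (simp add: s_def)
  have s1: "s \<le> 1" using a pos by (simp add: s_def field_simps)
  have [measurable]: "g \<in> borel_measurable N" using B unfolding g_def by measurable
  have X [measurable]: "X i \<in> measurable M N" if "i \<in> I" for i
    using ind that by (simp add: indep_vars_def2)
  have int: "integrable M (\<lambda>\<omega>. g (X i \<omega>))" if "i \<in> I" for i
  proof (rule integrable_const_bound[where B=1])
    show "(\<lambda>\<omega>. g (X i \<omega>)) \<in> borel_measurable M" using that by measurable
  qed (use s0 s1 in \<open>auto simp: g_def\<close>)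
  have ev: "{\<omega>\<in>space M. X i \<omega> \<in> B} \<in> events" if "i \<in> I" for i
    using measurable_sets[OF X[OF that] B] by (simp add: vimage_def Int_def conj_commute)
  have exp_g: "expectation (\<lambda>\<omega>. g (X i \<omega>)) = 1 - p + p * s" if "i \<in> I" for i
  proof -
    define A where "A = {\<omega>\<in>space M. X i \<omega> \<in> B}"
    have A: "A \<in> events" "prob A = p" using ev[OF that] p[OF that] by (simp_all add: A_def)
    have intA: "integrable M (indicator A :: _ \<Rightarrow> real)"
      using A(1) by (simp add: integrable_real_indicator emeasure_eq_measure)
    have exp_A: "expectation (indicator A) = p"
      using A sets.Int_space_eq2[of A M] by simp
    have "expectation (\<lambda>\<omega>. g (X i \<omega>))
        = expectation (\<lambda>\<omega>. 1 + (s - 1) * indicator A \<omega>)"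
      by (intro Bochner_Integration.integral_cong) (auto simp: g_def A_def indicator_def)
    also have "\<dots> = 1 + (s - 1) * p"
      using intA exp_A by (simp add: prob_space)
    finally show ?thesis by (simp add: algebra_simps)
  qed
  have ind_g: "indep_vars (\<lambda>_. borel) (\<lambda>i \<omega>. g (X i \<omega>)) I"
    by (rule indep_vars_compose2[OF ind]) measurable
  have EV: "expectation V = (1 - p + p * s) ^ n"
    using indep_vars_lebesgue_integral[OF fin ind_g int] exp_g by (simp add: V_def n_def)
  have intV: "integrable M V"
    unfolding V_def by (rule indep_vars_integrable[OF fin ind_g int])
  have V0: "0 \<le> V \<omega>" for \<omega> using s0 by (auto simp: V_def g_def intro!: prod_nonneg)
  have Vk: "V \<omega> = s ^ k \<omega>" for \<omega>
  proof -
    have "V \<omega> = (\<Prod>i\<in>{i\<in>I. X i \<omega> \<in> B}. s)"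
      unfolding V_def g_def using fin by (simp add: prod.If_cases Int_def)
    then show ?thesis by (simp add: k_def)
  qed
  have "prob {\<omega>\<in>space M. real (k \<omega>) \<le> a * real n} \<le> prob {\<omega>\<in>space M. s powr (a * real n) \<le> V \<omega>}"
  proof (rule finite_measure_mono)
    show "{\<omega>\<in>space M. s powr (a * real n) \<le> V \<omega>} \<in> events" using intV by measurable
    show "{\<omega>\<in>space M. real (k \<omega>) \<le> a * real n} \<subseteq> {\<omega>\<in>space M. s powr (a * real n) \<le> V \<omega>}"
      using s0 s1 by (auto simp: Vk powr_realpow[symmetric] intro!: powr_mono')
  qed
  also have "\<dots> \<le> expectation V / s powr (a * real n)"
    by (rule integral_Markov_inequality_measure[OF intV, where A="{}"]) (use V0 s0 in auto)
  also have "\<dots> = exp (- (real n * (a * ln (a / p) + (1 - a) * ln ((1 - a) / (1 - p)))))"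
  proof -
    have mean: "1 - p + p * s = (1 - p) / (1 - a)"
      using pos by (simp add: s_def field_simps)
    have "expectation V = exp (real n * ln ((1 - p) / (1 - a)))"
      using pos by (simp add: EV mean exp_of_nat_mult)
    moreover have "s powr (a * real n) = exp (a * real n * ln s)"
      using s0 by (simp add: powr_def)
    ultimately have "expectation V / s powr (a * real n)
        = exp (real n * ln ((1 - p) / (1 - a)) - a * real n * ln s)"
      by (simp add: exp_diff)
    moreover have "ln s = ln a + ln (1 - p) - ln p - ln (1 - a)"
      using a pos by (simp add: s_def ln_div ln_mult)
    ultimately show ?thesis
      using a pos by (simp add: ln_div algebra_simps)
  qed
  finally show ?thesis by (simp add: k_def n_def)
qed

text \<open>
  For \<open>p = 1\<close> and \<open>a < 1\<close> the relative entropy is infinite, which matches the fact that all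
  indices are then counted almost surely.
\<close>

lemma chernoff_lower_tail_KL:
  fixes X :: "'i \<Rightarrow> 'a \<Rightarrow> 'b"
  assumes fin: "finite I" and ind: "indep_vars (\<lambda>_. N) X I" and B: "B \<in> sets N"
    and p: "\<And>i. i \<in> I \<Longrightarrow> prob {\<omega>\<in>space M. X i \<omega> \<in> B} = p"
    and a: "0 < a" "a \<le> p" and p1: "p \<le> 1"
  shows "ereal (prob {\<omega>\<in>space M. real (card {i\<in>I. X i \<omega> \<in> B}) \<le> a * real (card I)})
         \<le> ereal_exp (- (ereal (real (card I)) * KL a p))"
    (is "ereal (prob ?E) \<le> _")
proof -
  consider "p < 1" | "p = 1" "a = 1" | "p = 1" "a < 1" "I = {}" | "p = 1" "a < 1" "I \<noteq> {}"
    using a p1 by linarith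
  then show ?thesis
  proof cases
    case 1
    then have "KL a p = ereal (a * ln (a / p) + (1 - a) * ln ((1 - a) / (1 - p)))"
      using a by (simp add: KL_def kl_term_def)
    then show ?thesis
      using chernoff_lower_tail[OF fin ind B p a 1] by (simp add: ereal_exp_def)
  next
    case 2
    then have "KL a p = 0" by (simp add: KL_def kl_term_def)
    then show ?thesis by (simp add: ereal_exp_def)
  next
    case 3
    then show ?thesis by (simp add: ereal_exp_def)
  next
    case 4
    then have n: "0 < card I" using fin by (simp add: card_gt_0_iff)
    have "KL a p = \<infinity>" using 4 a by (simp add: KL_def kl_term_def)
    then have rhs: "ereal_exp (- (ereal (real (card I)) * KL a p)) = 0"
      using n by (simp add: ereal_exp_def)
    have "AE \<omega> in M. X i \<omega> \<in> B" if "i \<in> I" for i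
    proof -
      have "X i \<in> measurable M N" using ind that by (simp add: indep_vars_def2)
      from measurable_sets[OF this B]
      have "{\<omega>\<in>space M. X i \<omega> \<in> B} \<in> events" by (simp add: vimage_def Int_def conj_commute)
      then show ?thesis using p[OF that] 4 by (simp add: prob_Collect_eq_1)
    qed
    then have "AE \<omega> in M. \<forall>i\<in>I. X i \<omega> \<in> B"
      using fin by (simp add: AE_finite_all)
    then have "AE \<omega> in M. \<omega> \<notin> ?E"
    proof eventually_elim
      case (elim \<omega>)
      then have "{i\<in>I. X i \<omega> \<in> B} = I" by auto
      then show ?case using n 4 by simp
    qed
    then have "prob ?E = 0"
      by (cases "?E \<in> events") (simp_all add: prob_eq_0 measure_notin_sets)
    then show ?thesis by (simp add: rhs)
  qed
qed

end

section \<open>Concentration of the empirical median\<close>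

theorem theorem4p11:
  fixes M :: "'w measure"
    and Y :: "'w \<Rightarrow> 'a::hadamard_space"
    and Ys :: "nat \<Rightarrow> 'w \<Rightarrow> 'a"
    and \<phi> :: "(nat \<Rightarrow> 'a) \<Rightarrow> 'a"
    and z m :: 'a
    and m\<^sub>n :: "'w \<Rightarrow> 'a"
    and n :: nat
    and r \<rho> \<eta> :: real
  assumes "prob_space M"
    and "Y \<in> M \<rightarrow>\<^sub>M borel"
    and "concentrated_on_separable M Y"
    and "frechet_median M Y z m"
    and "prob_space.indep_vars M (\<lambda>_. borel) Ys {1..n}"
    and "\<And>j. j \<in> {1..n} \<Longrightarrow> distr M borel (Ys j) = distr M borel Y"
    and "\<phi> \<in> (\<Pi>\<^sub>M j\<in>{1..n}. borel) \<rightarrow>\<^sub>M borel"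
    and "\<And>\<omega>. \<omega> \<in> space M \<Longrightarrow> m\<^sub>n \<omega> = \<phi> (\<lambda>j\<in>{1..n}. Ys j \<omega>)"
    and "\<And>\<omega>. \<omega> \<in> space M \<Longrightarrow> empirical_frechet_median n (\<lambda>j. Ys j \<omega>) (m\<^sub>n \<omega>)"
    and "r \<ge> 0"
    and "\<rho> = measure M {\<omega> \<in> space M. dist (Y \<omega>) m \<le> r}"
    and "0 < \<eta>" and "\<eta> \<le> 1"
    and "2 * \<eta> * \<rho> > 1"
  shows "ereal (measure M {\<omega> \<in> space M.
            dist m (m\<^sub>n \<omega>) > (6 * \<eta> * \<rho> - 1 - 4 * \<eta>\<^sup>2 * \<rho>\<^sup>2) / (2 * \<eta> * \<rho> - 1) * r})
         \<le> ereal_exp (- (ereal (real n) * KL (\<eta> * \<rho>) \<rho>))"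
proof -
  interpret prob_space M by fact
  define a where "a = \<eta> * \<rho>"
  define C where "C = (6 * a - 1 - 4 * a\<^sup>2) / (2 * a - 1)"
  define B where "B = cball m r"
  have \<rho>: "0 \<le> \<rho>" "\<rho> \<le> 1" using assms(11) by auto
  have a: "2 * a > 1" "0 < a" "a \<le> \<rho>" "a \<le> 1"
    using assms(12-14) \<rho> mult_right_mono[of \<eta> 1 \<rho>] by (auto simp: a_def)
  have B: "B \<in> sets borel" by (simp add: B_def)
  have Ys: "Ys j \<in> measurable M borel" if "j \<in> {1..n}" for j
    using assms(5) that by (simp add: indep_vars_def2)
  have ball: "prob {\<omega>\<in>space M. Ys j \<omega> \<in> B} = \<rho>" if j: "j \<in> {1..n}" for j
  proof -
    have "prob {\<omega>\<in>space M. Ys j \<omega> \<in> B} = measure (distr M borel (Ys j)) B"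
      using Ys[OF j] B by (simp add: measure_distr vimage_def Int_def conj_commute)
    also have "\<dots> = measure (distr M borel Y) B"
      using assms(6)[OF j] by simp
    also have "\<dots> = \<rho>"
      using assms(2) B
      by (simp add: assms(11) measure_distr vimage_def Int_def conj_commute B_def dist_commute)
    finally show ?thesis .
  qed
  let ?K = "\<lambda>\<omega>. card {j\<in>{1..n}. Ys j \<omega> \<in> B}"
  have near: "dist m (m\<^sub>n \<omega>) \<le> C * r" if \<omega>: "\<omega> \<in> space M" and K: "a * real n < real (?K \<omega>)" for \<omega>
  proof -
    have "(2 * a - 1) * (dist (m\<^sub>n \<omega>) m)\<^sup>2 \<le> a\<^sup>2 * r\<^sup>2"
    proof (rule median_near_majority[where I="{1..n}" and y="\<lambda>j. Ys j \<omega>"])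
      show "(\<Sum>j\<in>{1..n}. dist (Ys j \<omega>) (m\<^sub>n \<omega>)) \<le> (\<Sum>j\<in>{1..n}. dist (Ys j \<omega>) q)" for q
        using assms(9)[OF \<omega>]
        by (auto simp: empirical_frechet_median_def is_arg_min_linorder)
    qed (use K a assms(10) in \<open>auto simp: B_def dist_commute\<close>)
    moreover have C0: "0 \<le> C" and "a\<^sup>2 \<le> C\<^sup>2 * (2 * a - 1)"
    proof -
      define N where "N = 6 * a - 1 - 4 * a\<^sup>2"
      have CN: "C = N / (2 * a - 1)" by (simp add: C_def N_def)
      have "0 \<le> 2 * (1 - a) * (2 * a - 1)" using a by simp
      also have "\<dots> = N - 1" by (simp add: N_def power2_eq_square algebra_simps)
      finally have N: "1 \<le> N" by simp
      have "a\<^sup>2 * (2 * a - 1) \<le> 1 * 1"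
        using a by (intro mult_mono) (auto simp: power_le_one)
      also have "\<dots> \<le> N\<^sup>2" using N by simp
      finally have "a\<^sup>2 \<le> N\<^sup>2 / (2 * a - 1)" using a by (simp add: pos_le_divide_eq)
      also have "\<dots> = C\<^sup>2 * (2 * a - 1)"
        using a CN by (simp add: power_divide power2_eq_square)
      finally show "a\<^sup>2 \<le> C\<^sup>2 * (2 * a - 1)" .
      show "0 \<le> C" using N a by (simp add: CN)
    qed
    ultimately have "(2 * a - 1) * (dist (m\<^sub>n \<omega>) m)\<^sup>2 \<le> (C\<^sup>2 * (2 * a - 1)) * r\<^sup>2"
      by (meson mult_right_mono order_trans zero_le_power2)
    also have "\<dots> = (2 * a - 1) * (C * r)\<^sup>2" by (simp add: power_mult_distrib)
    finally have "(dist (m\<^sub>n \<omega>) m)\<^sup>2 \<le> (C * r)\<^sup>2"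
      using a by simp
    then show ?thesis
      using C0 assms(10) power2_le_imp_le[of "dist (m\<^sub>n \<omega>) m" "C * r"] by (simp add: dist_commute)
  qed
  have meas: "{\<omega>\<in>space M. real (?K \<omega>) \<le> a * real n} \<in> events"
  proof -
    have [measurable]: "{\<omega>\<in>space M. Ys j \<omega> \<in> B} \<in> events" if "j \<in> {1..n}" for j
      using measurable_sets[OF Ys[OF that] B] by (simp add: vimage_def Int_def conj_commute)
    have "real (?K \<omega>) = (\<Sum>j\<in>{1..n}. indicator {\<omega>\<in>space M. Ys j \<omega> \<in> B} \<omega>)"
      if "\<omega> \<in> space M" for \<omega>
      using that by (simp add: indicator_def sum.If_cases Int_def)
    then have "{\<omega>\<in>space M. real (?K \<omega>) \<le> a * real n}
        = {\<omega>\<in>space M. (\<Sum>j\<in>{1..n}. indicator {\<omega>\<in>space M. Ys j \<omega> \<in> B} \<omega>) \<le> a * real n}"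
      by (metis (mono_tags, lifting))
    also have "\<dots> \<in> events" by measurable
    finally show ?thesis .
  qed
  have "{\<omega>\<in>space M. dist m (m\<^sub>n \<omega>) > C * r} \<subseteq> {\<omega>\<in>space M. real (?K \<omega>) \<le> a * real n}"
    using near by (smt (verit) Collect_mono)
  then have "prob {\<omega>\<in>space M. dist m (m\<^sub>n \<omega>) > C * r} \<le> prob {\<omega>\<in>space M. real (?K \<omega>) \<le> a * real n}"
    using meas by (rule finite_measure_mono)
  then have "ereal (prob {\<omega>\<in>space M. dist m (m\<^sub>n \<omega>) > C * r})
      \<le> ereal (prob {\<omega>\<in>space M. real (?K \<omega>) \<le> a * real n})"
    unfolding ereal_less_eq .
  also have "\<dots> \<le> ereal_exp (- (ereal (real n) * KL a \<rho>))"
    using chernoff_lower_tail_KL[OF finite_atLeastAtMost assms(5) B ball a(2,3) \<rho>(2)]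
    unfolding card_atLeastAtMost by simp
  finally have tail: "ereal (prob {\<omega>\<in>space M. dist m (m\<^sub>n \<omega>) > C * r})
      \<le> ereal_exp (- (ereal (real n) * KL a \<rho>))" .
  have "C = (6 * \<eta> * \<rho> - 1 - 4 * \<eta>\<^sup>2 * \<rho>\<^sup>2) / (2 * \<eta> * \<rho> - 1)"
    by (simp add: C_def a_def power_mult_distrib mult.assoc)
  with tail show ?thesis unfolding a_def by (simp only:)
qed

end
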